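(* Any Banach space $X$ ordered by a reflexive and normal cone $P$ is Dedekind complete.
   Context: All spaces are real. $B_X$ is the closed unit ball of $X$. A cone of $X$ is a nonempty convex set $P\subseteq X$ with $\lambda P\subseteq P$ for every real $\lambda\ge 0$. It induces the order $x\le y\iff y-x\in P$ on $X$. $P$ is reflexive if $P\cap B_X$ is weakly compact. $P$ is normal if there is $c\in\mathbb{R}$ such that $0\le x\le y$ implies $\|x\|\le c\|y\|$ for any $x,y\in X$ (a normal cone is pointed). $X$ is Dedekind complete if any increasing net of $X$ which is bounded from above has a supremum in $X$. *)

theory Defs
  imports "HOL-Analysis.Analysis"
begin

text \<open>The coarsest topology making every continuous linear functional continuous.\<close>

definition weak_topology :: "'a::real_normed_vector topology" where
  "weak_topology =
     topology_generated_by {f -` U | (f :: 'a \<Rightarrow> real) U. bounded_linear f \<and> open U}"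

text \<open>A cone is a \<^const>\<open>convex_cone\<close>: nonempty, convex and closed under multiplication by
  nonnegative reals. It need be neither norm-closed nor pointed.\<close>

definition cone_le :: "'a::real_vector set \<Rightarrow> 'a \<Rightarrow> 'a \<Rightarrow> bool" where
  "cone_le P x y \<longleftrightarrow> y - x \<in> P"

definition reflexive_cone :: "'a::real_normed_vector set \<Rightarrow> bool" where
  "reflexive_cone P \<longleftrightarrow> compactin weak_topology (P \<inter> cball 0 1)"

definition normal_cone :: "'a::real_normed_vector set \<Rightarrow> bool" where
  "normal_cone P \<longleftrightarrow>
     (\<exists>c::real. \<forall>x y. cone_le P 0 x \<and> cone_le P x y \<longrightarrow> norm x \<le> c * norm y)"

text \<open>A directed set is a nonempty preordered set in which any two elements have a common upper
  bound; \<open>(i, j) \<in> r\<close> means that \<open>i\<close> is below \<open>j\<close>.\<close>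

definition directed_set :: "'i set \<Rightarrow> 'i rel \<Rightarrow> bool" where
  "directed_set I r \<longleftrightarrow>
     I \<noteq> {} \<and> preorder_on I r \<and> (\<forall>i\<in>I. \<forall>j\<in>I. \<exists>k\<in>I. (i, k) \<in> r \<and> (j, k) \<in> r)"

definition increasing_net ::
    "'a::real_vector set \<Rightarrow> 'i set \<Rightarrow> 'i rel \<Rightarrow> ('i \<Rightarrow> 'a) \<Rightarrow> bool" where
  "increasing_net P I r x \<longleftrightarrow>
     directed_set I r \<and> (\<forall>i\<in>I. \<forall>j\<in>I. (i, j) \<in> r \<longrightarrow> cone_le P (x i) (x j))"

definition upper_bound :: "'a::real_vector set \<Rightarrow> 'a set \<Rightarrow> 'a \<Rightarrow> bool" where
  "upper_bound P A b \<longleftrightarrow> (\<forall>a\<in>A. cone_le P a b)"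

definition supremum :: "'a::real_vector set \<Rightarrow> 'a set \<Rightarrow> 'a \<Rightarrow> bool" where
  "supremum P A s \<longleftrightarrow> upper_bound P A s \<and> (\<forall>b. upper_bound P A b \<longrightarrow> cone_le P s b)"

text \<open>HOL formulas cannot quantify over types, so the type \<open>'i\<close> from which the index sets of
  nets are drawn is a parameter. A theorem concluding \<open>dedekind_complete TYPE('i) P\<close> with
  \<open>'i\<close> a free type variable holds for nets with arbitrary index sets.\<close>

definition dedekind_complete :: "'i itself \<Rightarrow> 'a::real_vector set \<Rightarrow> bool" where
  "dedekind_complete _ P \<longleftrightarrow>
     (\<forall>(I :: 'i set) r x. increasing_net P I r x \<and> (\<exists>b. upper_bound P (x ` I) b)
        \<longrightarrow> (\<exists>s. supremum P (x ` I) s))"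

end

theory Submission
  imports Defs
begin

text \<open>The theorem is a compactness argument. An increasing net \<open>x\<close> bounded above by \<open>b\<close> is, from
  the index \<open>i\<close> on, trapped in the order interval \<open>[x i, b]\<close>. Hence the intervals \<open>[x i, b]\<close>,
  with \<open>i\<close> an index and \<open>b\<close> an upper bound of the net, have the finite intersection property: a
  late enough member of the net lies in any finitely many of them. A point common to all of these
  intervals is above every \<open>x i\<close> and below every upper bound, that is, it is a supremum. Such a
  point exists as soon as every order interval is weakly compact and weakly closed.

  Weak compactness is where the two hypotheses on the cone meet (\<open>compactin_order_interval\<close>).
  Normality bounds the interval \<open>[a, b]\<close> in norm, so that it is the intersection of a translate of
  \<open>P \<inter> cball 0 R\<close> with a translate of its reflection. Reflexivity makes both sets weakly compact.

  Weak closedness of compact sets, and compactness of their intersections, need the weak topology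
  to be Hausdorff, and this is the Hahn-Banach theorem: bounded linear functionals separate points
  (\<open>bounded_linear_separates_zero\<close>). The functionals are obtained as minimal elements among the
  sublinear functionals. By Zorn's lemma there are minimal ones below the norm, and a minimal
  sublinear functional is linear, because a sublinear functional \<open>p\<close> with
  \<open>p (- y) > - p y\<close> for some \<open>y\<close> can be made smaller at \<open>- y\<close>.\<close>

section \<open>Sublinear functionals\<close>

text \<open>The inequality in the second clause is equivalent to equality, as one sees by applying it to
  \<open>1 / t\<close>. It also forces \<open>p 0 = 0\<close>. Requiring no more than this keeps the verification short for
  functionals defined as infima.\<close>

definition sublinear :: "('a::real_vector \<Rightarrow> real) \<Rightarrow> bool" where
  "sublinear p \<longleftrightarrow>
     (\<forall>x y. p (x + y) \<le> p x + p y) \<and> (\<forall>t>0. \<forall>x. p (t *\<^sub>R x) \<le> t * p x)"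

lemma sublinearI:
  assumes "\<And>x y. p (x + y) \<le> p x + p y" and "\<And>t x. t > 0 \<Longrightarrow> p (t *\<^sub>R x) \<le> t * p x"
  shows "sublinear p"
  using assms by (auto simp: sublinear_def)

lemma sublinear_add: "sublinear p \<Longrightarrow> p (x + y) \<le> p x + p y"
  by (simp add: sublinear_def)

lemma sublinear_scale: "sublinear p \<Longrightarrow> t > 0 \<Longrightarrow> p (t *\<^sub>R x) \<le> t * p x"
  by (simp add: sublinear_def)

lemma sublinear_zero:
  assumes "sublinear p"
  shows "p 0 = 0"
  using sublinear_scale[OF assms, of 2 0] sublinear_scale[OF assms, of "1/2" 0] by simp

lemma sublinear_ge_minus:
  assumes "sublinear p"
  shows "- p (- x) \<le> p x"
  using sublinear_add[OF assms, of x "- x"] sublinear_zero[OF assms] by simp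

lemma sublinear_norm: "sublinear (norm :: 'a::real_normed_vector \<Rightarrow> real)"
  by (rule sublinearI) (auto simp: norm_triangle_ineq)

lemma linear_if_sublinear_odd:
  assumes p: "sublinear p" and odd: "\<And>x. p (- x) = - p x"
  shows "linear p"
proof (rule linearI)
  fix x y
  have "- p (x + y) \<le> - p x - p y"
    using sublinear_add[OF p, of "- x" "- y"] odd[of "x + y"] odd[of x] odd[of y] by simp
  then show "p (x + y) = p x + p y"
    using sublinear_add[OF p, of x y] by simp
next
  fix t :: real and x
  have pos: "p (s *\<^sub>R x) = s * p x" if "s > 0" for s
    using sublinear_scale[OF p that, of x] sublinear_scale[OF p that, of "- x"]
      odd[of "s *\<^sub>R x"] odd[of x] by simp
  show "p (t *\<^sub>R x) = t *\<^sub>R p x"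
  proof (cases t "0::real" rule: linorder_cases)
    case less
    then show ?thesis
      using pos[of "- t"] odd[of "t *\<^sub>R x"] by simp
  next
    case equal
    then show ?thesis
      by (simp add: sublinear_zero[OF p])
  next
    case greater
    then show ?thesis
      by (simp add: pos)
  qed
qed

text \<open>The largest sublinear functional below \<open>p\<close> whose value at \<open>- y\<close> is at most \<open>- p y\<close>, so
  that its value at \<open>y\<close> is still \<open>p y\<close>.\<close>

definition tilt :: "('a::real_vector \<Rightarrow> real) \<Rightarrow> 'a \<Rightarrow> 'a \<Rightarrow> real" where
  "tilt p y x = (INF t\<in>{0..}. p (x + t *\<^sub>R y) - t * p y)"

lemma bdd_below_tilt:
  assumes p: "sublinear p"
  shows "bdd_below ((\<lambda>t. p (x + t *\<^sub>R y) - t * p y) ` {0..})"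
proof (rule bdd_belowI2)
  fix t :: real
  assume "t \<in> {0..}"
  have "t * p y = p (t *\<^sub>R y)"
  proof (cases "t = 0")
    case False
    with \<open>t \<in> {0..}\<close> have "t > 0"
      by simp
    then show ?thesis
      using sublinear_scale[OF p \<open>t > 0\<close>, of y] sublinear_scale[OF p, of "1 / t" "t *\<^sub>R y"]
      by (simp add: field_simps)
  qed (simp add: sublinear_zero[OF p])
  also have "\<dots> \<le> p (x + t *\<^sub>R y) + p (- x)"
    using sublinear_add[OF p, of "x + t *\<^sub>R y" "- x"] by simp
  finally show "- p (- x) \<le> p (x + t *\<^sub>R y) - t * p y"
    by simp
qed

lemma tilt_le:
  assumes "sublinear p" and "t \<ge> 0"
  shows "tilt p y x \<le> p (x + t *\<^sub>R y) - t * p y"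
  unfolding tilt_def by (rule cINF_lower[OF bdd_below_tilt[OF assms(1)]]) (use assms(2) in simp)

lemma tilt_greatest:
  assumes "\<And>t. t \<ge> 0 \<Longrightarrow> c \<le> p (x + t *\<^sub>R y) - t * p y"
  shows "c \<le> tilt p y x"
  unfolding tilt_def by (rule cINF_greatest) (use assms in auto)

lemma sublinear_tilt:
  assumes p: "sublinear p"
  shows "sublinear (tilt p y)"
proof (rule sublinearI)
  fix x z
  have "tilt p y (x + z) - (p (z + s *\<^sub>R y) - s * p y) \<le> tilt p y x" if s: "s \<ge> 0" for s
  proof (rule tilt_greatest)
    fix t :: real
    assume t: "t \<ge> 0"
    have "tilt p y (x + z) \<le> p (x + z + (t + s) *\<^sub>R y) - (t + s) * p y"
      using s t by (intro tilt_le p) simp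
    also have "x + z + (t + s) *\<^sub>R y = (x + t *\<^sub>R y) + (z + s *\<^sub>R y)"
      by (simp add: algebra_simps)
    finally show "tilt p y (x + z) - (p (z + s *\<^sub>R y) - s * p y) \<le> p (x + t *\<^sub>R y) - t * p y"
      using sublinear_add[OF p, of "x + t *\<^sub>R y" "z + s *\<^sub>R y"] by (simp add: algebra_simps)
  qed
  then have "tilt p y (x + z) - tilt p y x \<le> tilt p y z"
    by (intro tilt_greatest) (simp add: algebra_simps)
  then show "tilt p y (x + z) \<le> tilt p y x + tilt p y z"
    by simp
next
  fix s :: real and x
  assume s: "s > 0"
  have "tilt p y (s *\<^sub>R x) / s \<le> tilt p y x"
  proof (rule tilt_greatest)
    fix t :: real
    assume t: "t \<ge> 0"
    have "tilt p y (s *\<^sub>R x) \<le> p (s *\<^sub>R x + (s * t) *\<^sub>R y) - (s * t) * p y"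
      using s t by (intro tilt_le p) simp
    also have "s *\<^sub>R x + (s * t) *\<^sub>R y = s *\<^sub>R (x + t *\<^sub>R y)"
      by (simp add: algebra_simps)
    finally have "tilt p y (s *\<^sub>R x) \<le> s * (p (x + t *\<^sub>R y) - t * p y)"
      using sublinear_scale[OF p s, of "x + t *\<^sub>R y"] by (simp add: algebra_simps)
    then show "tilt p y (s *\<^sub>R x) / s \<le> p (x + t *\<^sub>R y) - t * p y"
      using s by (simp add: field_simps)
  qed
  then show "tilt p y (s *\<^sub>R x) \<le> s * tilt p y x"
    using s by (simp add: field_simps)
qed

lemma tilt_le_self: "sublinear p \<Longrightarrow> tilt p y x \<le> p x"
  using tilt_le[of p 0 y x] by simp

lemma tilt_minus_le: "sublinear p \<Longrightarrow> tilt p y (- y) \<le> - p y"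
  using tilt_le[of p 1 y "- y"] by (simp add: sublinear_zero)

section \<open>Bounded linear functionals separate points\<close>

text \<open>Below \<open>q\<close> sublinear functionals are bounded from below at each point, since
  \<open>p x \<ge> - p (- x) \<ge> - q (- x)\<close>. This is why the pointwise infimum of a chain exists. It is
  subadditive because any two members of the chain are comparable, so that the smaller one serves
  in both arguments.\<close>

lemma minimal_sublinear_exists:
  fixes q :: "'a::real_vector \<Rightarrow> real"
  assumes q: "sublinear q"
  obtains p where "sublinear p" and "p \<le> q" and "\<And>p'. sublinear p' \<Longrightarrow> p' \<le> p \<Longrightarrow> p' = p"
proof -
  define A where "A = {p. sublinear p \<and> p \<le> q}"
  have "\<exists>m\<in>A. \<forall>a\<in>A. a \<le> m \<longrightarrow> a = m"
  proof (rule predicate_Zorn)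
    show "partial_order_on A (relation_of (\<lambda>p p'. p' \<le> p) A)"
      by (rule partial_order_on_relation_ofI) auto
  next
    fix C
    assume C: "C \<in> Chains (relation_of (\<lambda>p p'. p' \<le> p) A)"
    have CA: "sublinear p \<and> p \<le> q" if "p \<in> C" for p
      using that C by (auto simp: Chains_def relation_of_def A_def)
    have chain: "p \<le> p' \<or> p' \<le> p" if "p \<in> C" "p' \<in> C" for p p'
      using that C by (auto simp: Chains_def relation_of_def)
    show "\<exists>u\<in>A. \<forall>a\<in>C. u \<le> a"
    proof (cases "C = {}")
      case True
      then show ?thesis
        using q by (auto simp: A_def)
    next
      case False
      define u where "u x = (INF p\<in>C. p x)" for x
      have bdd: "bdd_below ((\<lambda>p. p x) ` C)" for x
      proof (rule bdd_belowI2)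
        fix p
        assume "p \<in> C"
        then have "sublinear p" "p (- x) \<le> q (- x)"
          using CA by (auto simp: le_fun_def)
        then show "- q (- x) \<le> p x"
          using sublinear_ge_minus[of p x] by simp
      qed
      have lower: "u x \<le> p x" if "p \<in> C" for p x
        unfolding u_def by (rule cINF_lower[OF bdd that])
      have greatest: "c \<le> u x" if "\<And>p. p \<in> C \<Longrightarrow> c \<le> p x" for c x
        unfolding u_def by (rule cINF_greatest[OF False that])
      have "sublinear u"
      proof (rule sublinearI)
        fix x y
        have *: "u (x + y) \<le> p x + p' y" if p: "p \<in> C" "p' \<in> C" for p p'
          using chain[OF p]
        proof
          assume "p \<le> p'"
          have "u (x + y) \<le> p x + p y"
            using lower[OF p(1), of "x + y"] sublinear_add[of p x y] CA[OF p(1)] by simp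
          also have "\<dots> \<le> p x + p' y"
            using \<open>p \<le> p'\<close> by (simp add: le_fun_def)
          finally show ?thesis .
        next
          assume "p' \<le> p"
          have "u (x + y) \<le> p' x + p' y"
            using lower[OF p(2), of "x + y"] sublinear_add[of p' x y] CA[OF p(2)] by simp
          also have "\<dots> \<le> p x + p' y"
            using \<open>p' \<le> p\<close> by (simp add: le_fun_def)
          finally show ?thesis .
        qed
        have "u (x + y) - p' y \<le> u x" if "p' \<in> C" for p'
          using *[OF _ that] by (intro greatest) (simp add: algebra_simps)
        then have "u (x + y) - u x \<le> u y"
          by (intro greatest) (simp add: algebra_simps)
        then show "u (x + y) \<le> u x + u y"
          by simp
      next
        fix t :: real and x
        assume t: "t > 0"
        have "u (t *\<^sub>R x) / t \<le> p x" if "p \<in> C" for p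
          using lower[OF that, of "t *\<^sub>R x"] sublinear_scale[of p t x] CA[OF that] t
          by (simp add: field_simps)
        then have "u (t *\<^sub>R x) / t \<le> u x"
          by (rule greatest)
        then show "u (t *\<^sub>R x) \<le> t * u x"
          using t by (simp add: field_simps)
      qed
      moreover have "u \<le> q"
        using False lower CA by (meson all_not_in_conv le_fun_def order_trans)
      ultimately show ?thesis
        using lower by (auto simp: A_def le_fun_def)
    qed
  qed
  then obtain m where m: "m \<in> A" "\<And>a. a \<in> A \<Longrightarrow> a \<le> m \<Longrightarrow> a = m"
    by blast
  show thesis
  proof (rule that)
    show "sublinear m" "m \<le> q"
      using m(1) by (auto simp: A_def)
    show "p' = m" if "sublinear p'" "p' \<le> m" for p'
      using m that by (auto simp: A_def)
  qed
qed

text \<open>Tilting a minimal \<open>p\<close> in the direction \<open>y\<close> changes nothing, and so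
  \<open>p (- y) \<le> - p y\<close>.\<close>

lemma minimal_sublinear_linear:
  assumes p: "sublinear p" and minimal: "\<And>p'. sublinear p' \<Longrightarrow> p' \<le> p \<Longrightarrow> p' = p"
  shows "linear p"
proof (rule linear_if_sublinear_odd[OF p])
  fix y
  have "tilt p y = p"
    by (intro minimal sublinear_tilt p) (simp add: le_fun_def tilt_le_self p)
  then have "p (- y) \<le> - p y"
    using tilt_minus_le[OF p, of y] by simp
  then show "p (- y) = - p y"
    using sublinear_ge_minus[OF p, of y] by simp
qed

text \<open>A minimal functional below the norm is linear and bounded, but may vanish at \<open>x\<close>. Tilting
  the norm in the direction \<open>x\<close> beforehand forces the value \<open>norm x\<close> there.\<close>

lemma bounded_linear_separates_zero:
  fixes x :: "'a::real_normed_vector"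
  assumes "x \<noteq> 0"
  obtains f :: "'a \<Rightarrow> real" where "bounded_linear f" and "f x \<noteq> 0"
proof -
  obtain f where f: "sublinear f" "f \<le> tilt norm x"
      "\<And>p'. sublinear p' \<Longrightarrow> p' \<le> f \<Longrightarrow> p' = f"
    using minimal_sublinear_exists[OF sublinear_tilt[OF sublinear_norm]] by blast
  have lin: "linear f"
    using f minimal_sublinear_linear by blast
  have le: "f z \<le> norm z" for z
    using le_funD[OF f(2), of z] tilt_le_self[OF sublinear_norm, of x z] by simp
  have "bounded_linear f"
  proof (rule bounded_linear_intro[where K = 1])
    show "norm (f z) \<le> norm z * 1" for z
      using le[of z] le[of "- z"] linear_neg[OF lin, of z] by simp
  qed (auto simp: linear_add[OF lin] linear_scale[OF lin])
  moreover have "f (- x) \<le> - norm x"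
    using le_funD[OF f(2), of "- x"] tilt_minus_le[OF sublinear_norm, of x] by simp
  then have "f x \<noteq> 0"
    using assms linear_neg[OF lin, of x] by auto
  ultimately show thesis
    by (rule that)
qed

section \<open>The weak topology\<close>

lemma openin_weak_topology_vimage:
  fixes f :: "'a::real_normed_vector \<Rightarrow> real"
  assumes "bounded_linear f" and "open U"
  shows "openin weak_topology (f -` U)"
  unfolding weak_topology_def by (rule topology_generated_by_Basis) (use assms in blast)

lemma topspace_weak_topology [simp]: "topspace weak_topology = UNIV"
  using openin_subset[OF openin_weak_topology_vimage[OF bounded_linear_zero open_UNIV]] by auto

lemma Hausdorff_weak_topology: "Hausdorff_space (weak_topology :: 'a::real_normed_vector topology)"
  unfolding Hausdorff_space_def
proof (intro allI impI)
  fix x y :: 'a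
  assume "x \<in> topspace weak_topology \<and> y \<in> topspace weak_topology \<and> x \<noteq> y"
  then have "x - y \<noteq> 0"
    by simp
  then obtain f :: "'a \<Rightarrow> real" where f: "bounded_linear f" "f (x - y) \<noteq> 0"
    by (rule bounded_linear_separates_zero)
  have "f x \<noteq> f y"
    using f(2) linear_diff[OF bounded_linear.linear[OF f(1)], of x y] by simp
  from hausdorff[OF this]
  obtain U V where "open U" "open V" "f x \<in> U" "f y \<in> V" "U \<inter> V = {}"
    by blast
  then show "\<exists>U V. openin weak_topology U \<and> openin weak_topology V \<and> x \<in> U \<and> y \<in> V \<and> disjnt U V"
    using openin_weak_topology_vimage[OF f(1)]
    by (intro exI[of _ "f -` U"] exI[of _ "f -` V"]) (auto simp: disjnt_def)
qed

lemma continuous_map_weak_affine: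
  fixes a :: "'a::real_normed_vector"
  shows "continuous_map weak_topology weak_topology (\<lambda>x. a + t *\<^sub>R x)"
  unfolding weak_topology_def
proof (rule continuous_on_generated_topo, fold weak_topology_def)
  fix W
  assume "W \<in> {f -` U | (f :: 'a \<Rightarrow> real) U. bounded_linear f \<and> open U}"
  then obtain f :: "'a \<Rightarrow> real" and U where W: "W = f -` U" and f: "bounded_linear f" and U: "open U"
    by blast
  define V where "V = {s. f a + t * s \<in> U}"
  have "V = (\<lambda>s. f a + t * s) -` U"
    by (auto simp: V_def)
  then have "open V"
    using U by (auto intro!: open_vimage continuous_intros)
  moreover have "(\<lambda>x. a + t *\<^sub>R x) -` W = f -` V"
    using bounded_linear.linear[OF f] by (auto simp: W V_def linear_add linear_scale)
  ultimately show "openin weak_topology ((\<lambda>x. a + t *\<^sub>R x) -` W \<inter> topspace weak_topology)"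
    using openin_weak_topology_vimage[OF f] by simp
next
  have "(\<lambda>_::'a. 0::real) -` UNIV \<in> {f -` U | (f :: 'a \<Rightarrow> real) U. bounded_linear f \<and> open U}"
    using bounded_linear_zero open_UNIV by blast
  then show "(\<lambda>x. a + t *\<^sub>R x) ` topspace weak_topology
      \<subseteq> \<Union> {f -` U | (f :: 'a \<Rightarrow> real) U. bounded_linear f \<and> open U}"
    by auto
qed

section \<open>Weak compactness of order intervals\<close>

definition order_interval :: "'a::real_vector set \<Rightarrow> 'a \<Rightarrow> 'a \<Rightarrow> 'a set" where
  "order_interval P a b = {y. cone_le P a y \<and> cone_le P y b}"

text \<open>Dilating \<open>P \<inter> cball 0 1\<close> by \<open>r\<close> gives \<open>P \<inter> cball 0 r\<close>, and affine maps are weakly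
  continuous. With \<open>s = 1\<close> and \<open>s = -1\<close> the lemma covers the points above \<open>a\<close> and
  those below \<open>a\<close>, up to distance \<open>r\<close>.\<close>

lemma compactin_weak_cone_part:
  fixes P :: "'a::real_normed_vector set"
  assumes P: "convex_cone P" and refl: "reflexive_cone P" and r: "r > 0"
  shows "compactin weak_topology ((\<lambda>y. a + s *\<^sub>R y) ` (P \<inter> cball 0 r))"
proof -
  have scale: "t *\<^sub>R y \<in> P" if "y \<in> P" "t > 0" for y t
    using convex_cone_scaleR[OF P _ that(1), of t] that(2) by simp
  have "P \<inter> cball 0 r = (\<lambda>y. 0 + r *\<^sub>R y) ` (P \<inter> cball 0 1)"
  proof (intro equalityI subsetI)
    fix y
    assume "y \<in> P \<inter> cball 0 r"
    then have "(1 / r) *\<^sub>R y \<in> P \<inter> cball 0 1" "y = 0 + r *\<^sub>R ((1 / r) *\<^sub>R y)"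
      using r scale[of y "1 / r"] by auto
    then show "y \<in> (\<lambda>y. 0 + r *\<^sub>R y) ` (P \<inter> cball 0 1)"
      by blast
  next
    fix z
    assume "z \<in> (\<lambda>y. 0 + r *\<^sub>R y) ` (P \<inter> cball 0 1)"
    then show "z \<in> P \<inter> cball 0 r"
      using r scale by (auto simp: mult_left_le)
  qed
  then have "compactin weak_topology (P \<inter> cball 0 r)"
    using image_compactin[OF refl[unfolded reflexive_cone_def] continuous_map_weak_affine[of 0 r]]
    by simp
  then show ?thesis
    by (rule image_compactin[OF _ continuous_map_weak_affine])
qed

lemma compactin_order_interval:
  fixes P :: "'a::real_normed_vector set"
  assumes P: "convex_cone P" and refl: "reflexive_cone P" and normal: "normal_cone P"
  shows "compactin weak_topology (order_interval P a b)"
proof -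
  obtain c where c: "\<And>x y. cone_le P 0 x \<Longrightarrow> cone_le P x y \<Longrightarrow> norm x \<le> c * norm y"
    using normal unfolding normal_cone_def by blast
  (* Normality bounds both y - a and b - y by c * norm (b - a) when a \<le> y \<le> b. The maximum with 1
     makes the radius positive even when a = b or c < 0. *)
  define R where "R = max 1 (c * norm (b - a))"
  have "R > 0"
    by (simp add: R_def)
  define K where "K = (\<lambda>y. a + 1 *\<^sub>R y) ` (P \<inter> cball 0 R) \<inter> (\<lambda>y. b + (-1) *\<^sub>R y) ` (P \<inter> cball 0 R)"
  have "compactin weak_topology K"
    unfolding K_def by (intro compactin_Int Hausdorff_weak_topology compactin_weak_cone_part P refl \<open>R > 0\<close>)
  moreover have "order_interval P a b = K"
  proof (intro equalityI subsetI)
    fix y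
    assume "y \<in> order_interval P a b"
    then have y: "y - a \<in> P" "b - y \<in> P"
      by (auto simp: order_interval_def cone_le_def)
    have "norm (y - a) \<le> R" "norm (b - y) \<le> R"
      using c[of "y - a" "b - a"] c[of "b - y" "b - a"] y by (auto simp: cone_le_def R_def)
    then have "y - a \<in> P \<inter> cball 0 R" "b - y \<in> P \<inter> cball 0 R"
      using y by auto
    moreover have "y = a + 1 *\<^sub>R (y - a)" "y = b + (-1) *\<^sub>R (b - y)"
      by auto
    ultimately show "y \<in> K"
      unfolding K_def by blast
  next
    fix y
    assume "y \<in> K"
    then obtain u v where u: "u \<in> P" "y = a + 1 *\<^sub>R u" and v: "v \<in> P" "y = b + (-1) *\<^sub>R v"
      unfolding K_def by blast
    have "y - a = u"
      using u(2) by simp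
    moreover have "b - y = v"
      using v(2) by simp
    ultimately have "y - a \<in> P" "b - y \<in> P"
      using u(1) v(1) by simp_all
    then show "y \<in> order_interval P a b"
      by (simp add: order_interval_def cone_le_def)
  qed
  ultimately show ?thesis
    by simp
qed

section \<open>Suprema of increasing nets\<close>

lemma finite_family_meets_directed_net:
  assumes "directed_set I r" and "finite F"
    and "\<And>K. K \<in> F \<Longrightarrow> \<exists>i\<in>I. \<forall>j\<in>I. (i, j) \<in> r \<longrightarrow> x j \<in> K"
  shows "\<exists>i\<in>I. x i \<in> \<Inter>F"
proof -
  have refl: "(i, i) \<in> r" if "i \<in> I" for i
    using assms(1) that by (auto simp: directed_set_def preorder_on_def refl_on_def)
  have trans: "trans r"
    using assms(1) by (auto simp: directed_set_def preorder_on_def)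
  from assms(2,3) have "\<exists>i\<in>I. \<forall>j\<in>I. (i, j) \<in> r \<longrightarrow> x j \<in> \<Inter>F"
  proof (induction F rule: finite_induct)
    case empty
    then show ?case
      using assms(1) by (auto simp: directed_set_def)
  next
    case (insert K F)
    obtain i where i: "i \<in> I" "\<And>j. j \<in> I \<Longrightarrow> (i, j) \<in> r \<Longrightarrow> x j \<in> K"
      using insert.prems[of K] by blast
    obtain i' where i': "i' \<in> I" "\<And>j. j \<in> I \<Longrightarrow> (i', j) \<in> r \<Longrightarrow> x j \<in> \<Inter>F"
      using insert.IH[OF insert.prems[OF insertI2]] by blast
    obtain k where k: "k \<in> I" "(i, k) \<in> r" "(i', k) \<in> r"
      using assms(1) i(1) i'(1) by (auto simp: directed_set_def)
    have "x j \<in> \<Inter>(insert K F)" if "j \<in> I" "(k, j) \<in> r" for j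
      using i(2)[OF that(1) transD[OF trans k(2) that(2)]]
        i'(2)[OF that(1) transD[OF trans k(3) that(2)]] by simp
    then show ?case
      using k(1) by blast
  qed
  then show ?thesis
    using refl by blast
qed

theorem theorem7p1:
  fixes P :: "'a::banach set"
  assumes "convex_cone P"
    and "reflexive_cone P"
    and "normal_cone P"
  shows "dedekind_complete TYPE('i) P"
  unfolding dedekind_complete_def
proof (intro allI impI, elim conjE exE)
  fix I :: "'i set" and r x b\<^sub>0
  assume net: "increasing_net P I r x" and b\<^sub>0: "upper_bound P (x ` I) b\<^sub>0"
  have dir: "directed_set I r"
    and mono: "\<And>i j. i \<in> I \<Longrightarrow> j \<in> I \<Longrightarrow> (i, j) \<in> r \<Longrightarrow> cone_le P (x i) (x j)"
    using net by (auto simp: increasing_net_def)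
  obtain i\<^sub>0 where i\<^sub>0: "i\<^sub>0 \<in> I"
    using dir by (auto simp: directed_set_def)
  define \<U> where "\<U> = {order_interval P (x i) b | i b. i \<in> I \<and> upper_bound P (x ` I) b}"
  let ?S = "order_interval P (x i\<^sub>0) b\<^sub>0"
  have S: "?S \<in> \<U>"
    using i\<^sub>0 b\<^sub>0 by (auto simp: \<U>_def)
  have compact: "compactin weak_topology K" if "K \<in> \<U>" for K
    using that compactin_order_interval[OF assms] by (auto simp: \<U>_def)
  then have closed: "closedin weak_topology K" if "K \<in> \<U>" for K
    using that compactin_imp_closedin[OF Hausdorff_weak_topology] by blast
  have tail: "\<exists>i\<in>I. \<forall>j\<in>I. (i, j) \<in> r \<longrightarrow> x j \<in> K" if "K \<in> \<U>" for K
  proof -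
    obtain i b where K: "K = order_interval P (x i) b" and i: "i \<in> I" and b: "upper_bound P (x ` I) b"
      using \<open>K \<in> \<U>\<close> unfolding \<U>_def by blast
    have "x j \<in> K" if "j \<in> I" "(i, j) \<in> r" for j
      using mono[OF i that] b that(1) by (simp add: K order_interval_def upper_bound_def)
    then show ?thesis
      using i by blast
  qed
  have "?S \<inter> \<Inter>F \<noteq> {}" if F: "finite F" "F \<subseteq> \<U>" for F
  proof -
    have "\<exists>i\<in>I. x i \<in> \<Inter>(insert ?S F)"
      using F S by (intro finite_family_meets_directed_net[OF dir] tail) auto
    then show ?thesis
      by auto
  qed
  then have "?S \<inter> \<Inter>\<U> \<noteq> {}"
    using compact[OF S, unfolded compactin_fip, THEN conjunct2, rule_format, of \<U>] closed by simp
  then obtain s where s: "\<And>i b. i \<in> I \<Longrightarrow> upper_bound P (x ` I) b \<Longrightarrow> s \<in> order_interval P (x i) b"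
    unfolding \<U>_def by blast
  have "supremum P (x ` I) s"
    using s[OF _ b\<^sub>0] s[OF i\<^sub>0] by (auto simp: supremum_def upper_bound_def order_interval_def)
  then show "\<exists>s. supremum P (x ` I) s"
    by blast
qed

end
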